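(* Let $a,b,c$ be integers and $r,s,t$ real numbers, let $(V_n)_{n\ge 0}$ be the associated generalized Tribonacci sequence, and let $\varphi_n$ be the $n$th generalized Tribonacci hyperbolic spinor. Assume that the complex roots $\sigma_1,\sigma_2,\sigma_3$ of $x^3-rx^2-sx-t=0$ are pairwise distinct. Then, as power series in $y$, $$\sum_{n=0}^\infty \varphi_n\frac{y^n}{n!}=\frac{\zeta_1\Phi_1e^{\sigma_1y}}{(\sigma_1-\sigma_2)(\sigma_1-\sigma_3)}+\frac{\zeta_2\Phi_2e^{\sigma_2y}}{(\sigma_2-\sigma_1)(\sigma_2-\sigma_3)}+\frac{\zeta_3\Phi_3e^{\sigma_3y}}{(\sigma_3-\sigma_1)(\sigma_3-\sigma_2)},$$ where, for $k=1,2,3$, $\zeta_k=\begin{bmatrix}1+\sigma_k^3 j\\ (-1+\sigma_k j)\sigma_k\end{bmatrix}$, and $\Phi_1=c-(\sigma_2+\sigma_3)b+\sigma_2\sigma_3a$, $\Phi_2=c-(\sigma_1+\sigma_3)b+\sigma_1\sigma_3a$, $\Phi_3=c-(\sigma_1+\sigma_2)b+\sigma_1\sigma_2a$.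
   Context: Hyperbolic numbers are the elements $x+yj$ with $x,y\in\mathbb{R}$ and $j^2=1$ (a commutative ring). A hyperbolic spinor is a column vector with two hyperbolic number components; addition and scalar multiplication are componentwise. Since the $\sigma_k$ may be non-real, the right-hand side is computed with complex coefficients, i.e. in columns over the commutative ring $\mathbb{C}[j]/(j^2-1)$, which contains the hyperbolic numbers. Given integers $a,b,c$ and real numbers $r,s,t$, the generalized Tribonacci sequence $(V_n)_{n\ge0}$ is defined by $V_0=a$, $V_1=b$, $V_2=c$ and $V_n=rV_{n-1}+sV_{n-2}+tV_{n-3}$ for $n\ge 3$. The $n$th generalized Tribonacci hyperbolic spinor is $\varphi_n=\begin{bmatrix} V_n+V_{n+3}j\\ -V_{n+1}+V_{n+2}j\end{bmatrix}$, $n\ge 0$. Power series in $y$ are understood componentwise, with $e^{\sigma y}=\sum_{n\ge0}\sigma^ny^n/n!$. *)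

theory Defs
  imports "HOL-Analysis.Analysis"
begin

text \<open>
  \<open>'a hyp\<close> is the ring \<open>'a[j]/(j\<^sup>2 - 1)\<close>, with \<open>Hyp x y\<close> standing for \<open>x + y j\<close>.
  The hyperbolic numbers are \<open>real hyp\<close>; they embed into \<open>complex hyp\<close> by \<open>map_hyp of_real\<close>.
\<close>

datatype 'a hyp = Hyp (hre: 'a) (him: 'a)

lemma hyp_eq_iff: "z = w \<longleftrightarrow> hre z = hre w \<and> him z = him w"
  by (cases z; cases w) simp

instantiation hyp :: (comm_ring_1) comm_ring_1
begin

definition "0 = Hyp 0 0"
definition "1 = Hyp 1 0"
definition "z + w = Hyp (hre z + hre w) (him z + him w)"
definition "z - w = Hyp (hre z - hre w) (him z - him w)"
definition "- z = Hyp (- hre z) (- him z)"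
definition "z * w = Hyp (hre z * hre w + him z * him w) (hre z * him w + him z * hre w)"

instance
  by standard
    (simp_all add: hyp_eq_iff zero_hyp_def one_hyp_def plus_hyp_def minus_hyp_def
      uminus_hyp_def times_hyp_def algebra_simps)

end

definition hyp_of :: "'a::comm_ring_1 \<Rightarrow> 'a hyp"
  where "hyp_of x = Hyp x 0"

definition j :: "'a::comm_ring_1 hyp"
  where "j = Hyp 0 1"

lemma j_squared: "j * j = 1"
  by (simp add: j_def times_hyp_def one_hyp_def)

lemma Hyp_eq: "Hyp x y = hyp_of x + hyp_of y * j"
  by (simp add: hyp_of_def j_def times_hyp_def plus_hyp_def)

type_synonym hyp_spinor = "real hyp ^ 2"

fun gen_tribonacci :: "int \<Rightarrow> int \<Rightarrow> int \<Rightarrow> real \<Rightarrow> real \<Rightarrow> real \<Rightarrow> nat \<Rightarrow> real" where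
  "gen_tribonacci a b c r s t 0 = of_int a"
| "gen_tribonacci a b c r s t (Suc 0) = of_int b"
| "gen_tribonacci a b c r s t (Suc (Suc 0)) = of_int c"
| "gen_tribonacci a b c r s t (Suc (Suc (Suc n))) =
     r * gen_tribonacci a b c r s t (Suc (Suc n)) +
     s * gen_tribonacci a b c r s t (Suc n) +
     t * gen_tribonacci a b c r s t n"

definition tribonacci_spinor ::
    "int \<Rightarrow> int \<Rightarrow> int \<Rightarrow> real \<Rightarrow> real \<Rightarrow> real \<Rightarrow> nat \<Rightarrow> hyp_spinor" where
  "tribonacci_spinor a b c r s t n =
     (let V = gen_tribonacci a b c r s t in
      vector [hyp_of (V n) + hyp_of (V (n + 3)) * j,
              - hyp_of (V (n + 1)) + hyp_of (V (n + 2)) * j])"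

text \<open>
  Power series in \<open>y\<close> are formal and taken componentwise, so a series of spinors is a column
  of formal power series over \<open>complex hyp\<close>.  \<open>spinor_egf \<phi>\<close> is the series with \<open>n\<close>-th
  coefficient \<open>\<phi>\<^sub>n / n!\<close>.
\<close>

definition spinor_egf :: "(nat \<Rightarrow> hyp_spinor) \<Rightarrow> complex hyp fps ^ 2" where
  "spinor_egf \<phi> =
     (\<chi> i. Abs_fps (\<lambda>n. map_hyp of_real (\<phi> n $ i) * hyp_of (1 / fact n)))"

definition fps_hyp_of :: "'a::comm_ring_1 fps \<Rightarrow> 'a hyp fps"
  where "fps_hyp_of f = Abs_fps (\<lambda>n. hyp_of (fps_nth f n))"

definition const_col :: "'a::zero ^ 2 \<Rightarrow> 'a fps ^ 2"
  where "const_col v = (\<chi> i. fps_const (v $ i))"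

text \<open>The product of a column \<open>v\<close> over \<open>complex hyp\<close> and a scalar power series \<open>f\<close>.\<close>

definition col_times_fps :: "complex hyp ^ 2 \<Rightarrow> complex fps \<Rightarrow> complex hyp fps ^ 2"
  where "col_times_fps v f = fps_hyp_of f *s const_col v"

definition zeta_col :: "complex \<Rightarrow> complex hyp ^ 2" where
  "zeta_col \<sigma> = vector [1 + hyp_of (\<sigma> ^ 3) * j, (- 1 + hyp_of \<sigma> * j) * hyp_of \<sigma>]"

end

theory Submission
  imports Defs
begin

text \<open>
  The identity is the Binet formula
  \<open>V\<^sub>n = A\<^sub>1 \<sigma>\<^sub>1\<^sup>n + A\<^sub>2 \<sigma>\<^sub>2\<^sup>n + A\<^sub>3 \<sigma>\<^sub>3\<^sup>n\<close> with \<open>A\<^sub>k = \<Phi>\<^sub>k / \<Prod>\<^bsub>l\<noteq>k\<^esub> (\<sigma>\<^sub>k - \<sigma>\<^sub>l)\<close>, read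
  off one power of \<open>y\<close> at a time.

  Each sequence \<open>\<sigma>\<^sub>k\<^sup>n\<close> satisfies the recurrence, because \<open>\<sigma>\<^sub>k\<close> is a root of the characteristic
  polynomial; hence so does every linear combination of the three, and the formula holds
  for all \<open>n\<close> as soon as it holds for \<open>n = 0, 1, 2\<close>. Those three cases say that the \<open>A\<^sub>k\<close> solve a
  Vandermonde system (lemma \<open>vandermonde3_solution\<close>). Replacing \<open>V\<^sub>n\<close> by \<open>\<sigma>\<^sup>n\<close> in the definition of
  the spinor \<open>\<phi>\<^sub>n\<close> gives \<open>\<sigma>\<^sup>n \<zeta>\<close>, with \<open>\<zeta>\<close> the column attached to \<open>\<sigma>\<close>, so that the Binet formula
  becomes \<open>\<phi>\<^sub>n = \<Sum>\<^sub>k A\<^sub>k \<sigma>\<^sub>k\<^sup>n \<zeta>\<^sub>k\<close>; dividing by \<open>n!\<close> gives the coefficients of the exponential series.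
\<close>

text \<open>
  If weights \<open>A, B, C\<close> at the nodes \<open>x, y, z\<close> have moments \<open>u\<^sub>0, u\<^sub>1, u\<^sub>2\<close>, then the linear functional
  \<open>X\<^sup>i \<mapsto> u\<^sub>i\<close> applied to \<open>(X - y) (X - z)\<close>, which vanishes at \<open>y\<close> and \<open>z\<close>, isolates
  \<open>A (x - y) (x - z)\<close>. This explains the quotients below. That they have the right moments is
  checked after multiplication by the Vandermonde determinant, up to its sign.
\<close>

lemma vandermonde3_solution:
  fixes x y z u0 u1 u2 :: "'a::field"
  assumes "x \<noteq> y" "x \<noteq> z" "y \<noteq> z"
  defines "A \<equiv> (u2 - (y + z) * u1 + y * z * u0) / ((x - y) * (x - z))"
    and "B \<equiv> (u2 - (x + z) * u1 + x * z * u0) / ((y - x) * (y - z))"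
    and "C \<equiv> (u2 - (x + y) * u1 + x * y * u0) / ((z - x) * (z - y))"
  shows "A + B + C = u0"
    and "A * x + B * y + C * z = u1"
    and "A * x ^ 2 + B * y ^ 2 + C * z ^ 2 = u2"
proof -
  define D where "D = (x - y) * (x - z) * (y - z)"
  have "D \<noteq> 0"
    using assms(1-3) by (simp add: D_def)
  have A: "A * D = (u2 - (y + z) * u1 + y * z * u0) * (y - z)"
    and B: "B * D = - (u2 - (x + z) * u1 + x * z * u0) * (x - z)"
    and C: "C * D = (u2 - (x + y) * u1 + x * y * u0) * (x - y)"
    using assms(1-3) by (simp_all add: A_def B_def C_def D_def divide_simps)
      (simp_all add: algebra_simps)
  have "(A + B + C) * D = u0 * D"
    unfolding distrib_right A B C by (simp add: D_def algebra_simps)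
  then show "A + B + C = u0"
    using \<open>D \<noteq> 0\<close> by simp
  have "(A * x + B * y + C * z) * D = (A * D) * x + (B * D) * y + (C * D) * z"
    by (simp add: algebra_simps)
  also have "\<dots> = u1 * D"
    unfolding A B C by (simp add: D_def algebra_simps)
  finally show "A * x + B * y + C * z = u1"
    using \<open>D \<noteq> 0\<close> by simp
  have "(A * x ^ 2 + B * y ^ 2 + C * z ^ 2) * D
      = (A * D) * x ^ 2 + (B * D) * y ^ 2 + (C * D) * z ^ 2"
    by (simp add: algebra_simps)
  also have "\<dots> = u2 * D"
    unfolding A B C by (simp add: D_def algebra_simps power2_eq_square)
  finally show "A * x ^ 2 + B * y ^ 2 + C * z ^ 2 = u2"
    using \<open>D \<noteq> 0\<close> by simp
qed

text \<open>
  Both sides satisfy the same third-order recurrence, so agreement at \<open>0, 1, 2\<close> propagates.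
\<close>

lemma gen_tribonacci_binet:
  fixes x y z A B C :: complex
  assumes root:
      "x ^ 3 = of_real r * x ^ 2 + of_real s * x + of_real t"
      "y ^ 3 = of_real r * y ^ 2 + of_real s * y + of_real t"
      "z ^ 3 = of_real r * z ^ 2 + of_real s * z + of_real t"
    and init:
      "A + B + C = of_int a"
      "A * x + B * y + C * z = of_int b"
      "A * x ^ 2 + B * y ^ 2 + C * z ^ 2 = of_int c"
  shows "of_real (gen_tribonacci a b c r s t n) = A * x ^ n + B * y ^ n + C * z ^ n"
  using assms
proof (induction a b c r s t n rule: gen_tribonacci.induct)
  case (4 a b c r s t n)
  have "A * x ^ (n + 3) + B * y ^ (n + 3) + C * z ^ (n + 3)
      = A * x ^ n * x ^ 3 + B * y ^ n * y ^ 3 + C * z ^ n * z ^ 3"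
    by (simp add: power_add)
  also have "\<dots> = of_real r * (A * x ^ (n + 2) + B * y ^ (n + 2) + C * z ^ (n + 2))
      + of_real s * (A * x ^ (n + 1) + B * y ^ (n + 1) + C * z ^ (n + 1))
      + of_real t * (A * x ^ n + B * y ^ n + C * z ^ n)"
    unfolding "4.prems"(1-3) by (simp add: algebra_simps power2_eq_square)
  finally show ?case
    using 4 by (simp add: numeral_3_eq_3)
qed (simp_all add: power2_eq_square)

lemma hyp_sel [simp]:
  "hre 0 = 0" "him 0 = 0" "hre 1 = 1" "him 1 = 0"
  "hre (u + v) = hre u + hre v" "him (u + v) = him u + him v"
  "hre (u - v) = hre u - hre v" "him (u - v) = him u - him v"
  "hre (- u) = - hre u" "him (- u) = - him u"
  "hre (u * v) = hre u * hre v + him u * him v"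
  "him (u * v) = hre u * him v + him u * hre v"
  "hre (hyp_of w) = w" "him (hyp_of w) = 0" "hre j = 0" "him j = 1"
  by (simp_all add: zero_hyp_def one_hyp_def plus_hyp_def minus_hyp_def uminus_hyp_def times_hyp_def
      hyp_of_def j_def)

lemma spinor_egf_nth:
  "fps_nth (spinor_egf \<phi> $ i) n = map_hyp of_real (\<phi> n $ i) * hyp_of (1 / fact n)"
  by (simp add: spinor_egf_def)

lemma col_times_exp_nth:
  "fps_nth (col_times_fps v (fps_const A * fps_exp x) $ i) n = hyp_of (A * x ^ n / fact n) * v $ i"
  by (simp add: col_times_fps_def fps_hyp_of_def const_col_def)

text \<open>
  The entries of \<open>\<phi>\<^sub>n\<close> are linear in \<open>V\<close>, and shifting the index of a geometric sequence \<open>x\<^sup>n\<close> by \<open>m\<close>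
  multiplies it by \<open>x\<^sup>m\<close>; the shifts \<open>0, 3\<close> and \<open>1, 2\<close> in the two entries turn into the powers of
  \<open>x\<close> in \<open>\<zeta>\<close>.
\<close>

lemma tribonacci_spinor_binet:
  assumes V: "\<And>n. of_real (gen_tribonacci a b c r s t n) = A * x ^ n + B * y ^ n + C * z ^ n"
  shows "map_hyp of_real (tribonacci_spinor a b c r s t n $ i) =
    hyp_of (A * x ^ n) * zeta_col x $ i + hyp_of (B * y ^ n) * zeta_col y $ i
    + hyp_of (C * z ^ n) * zeta_col z $ i"
proof -
  have "i = 1 \<or> i = 2"
    by (rule exhaust_2)
  then show ?thesis
    by (auto simp: tribonacci_spinor_def zeta_col_def hyp_eq_iff hyp.map_sel V power_add
        Let_def algebra_simps power2_eq_square)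
qed

theorem theorem3p10:
  fixes a b c :: int and r s t :: real and \<sigma>1 \<sigma>2 \<sigma>3 \<Phi>1 \<Phi>2 \<Phi>3 :: complex
  assumes roots: "{x :: complex. x ^ 3 - of_real r * x ^ 2 - of_real s * x - of_real t = 0}
                    = {\<sigma>1, \<sigma>2, \<sigma>3}"
    and distinct: "\<sigma>1 \<noteq> \<sigma>2" "\<sigma>1 \<noteq> \<sigma>3" "\<sigma>2 \<noteq> \<sigma>3"
    and Phi1: "\<Phi>1 = of_int c - (\<sigma>2 + \<sigma>3) * of_int b + \<sigma>2 * \<sigma>3 * of_int a"
    and Phi2: "\<Phi>2 = of_int c - (\<sigma>1 + \<sigma>3) * of_int b + \<sigma>1 * \<sigma>3 * of_int a"
    and Phi3: "\<Phi>3 = of_int c - (\<sigma>1 + \<sigma>2) * of_int b + \<sigma>1 * \<sigma>2 * of_int a"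
  shows "spinor_egf (tribonacci_spinor a b c r s t) =
      col_times_fps (zeta_col \<sigma>1)
        (fps_const (\<Phi>1 / ((\<sigma>1 - \<sigma>2) * (\<sigma>1 - \<sigma>3))) * fps_exp \<sigma>1)
    + col_times_fps (zeta_col \<sigma>2)
        (fps_const (\<Phi>2 / ((\<sigma>2 - \<sigma>1) * (\<sigma>2 - \<sigma>3))) * fps_exp \<sigma>2)
    + col_times_fps (zeta_col \<sigma>3)
        (fps_const (\<Phi>3 / ((\<sigma>3 - \<sigma>1) * (\<sigma>3 - \<sigma>2))) * fps_exp \<sigma>3)"
proof -
  define A B C where "A = \<Phi>1 / ((\<sigma>1 - \<sigma>2) * (\<sigma>1 - \<sigma>3))"
    and "B = \<Phi>2 / ((\<sigma>2 - \<sigma>1) * (\<sigma>2 - \<sigma>3))"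
    and "C = \<Phi>3 / ((\<sigma>3 - \<sigma>1) * (\<sigma>3 - \<sigma>2))"
  have root: "x ^ 3 = of_real r * x ^ 2 + of_real s * x + of_real t" if "x \<in> {\<sigma>1, \<sigma>2, \<sigma>3}" for x
    using that unfolding roots[symmetric] by (simp add: algebra_simps)
  have V: "of_real (gen_tribonacci a b c r s t n) = A * \<sigma>1 ^ n + B * \<sigma>2 ^ n + C * \<sigma>3 ^ n" for n
    unfolding A_def B_def C_def Phi1 Phi2 Phi3
    by (intro gen_tribonacci_binet root vandermonde3_solution[OF distinct]) simp_all
  show ?thesis
    unfolding A_def[symmetric] B_def[symmetric] C_def[symmetric]
    by (simp add: vec_eq_iff fps_eq_iff spinor_egf_nth col_times_exp_nth
        tribonacci_spinor_binet[OF V] hyp_eq_iff algebra_simps add_divide_distrib)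
qed

end
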